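(* For $t\ge 0$, the cumulative distribution function of the time to sale $T_t$ is given, for $r\ge0$, by $$H_t(r)=P(T_t\le r)=\begin{cases}1-\frac{\phi(\mu(t))}{\phi(\mu(t-r))} & r<t\\ 1 & r\ge t.\end{cases}$$ In particular, the probability that a sale is not made up to the deadline is given by $$P(T_t=t)=H_t(t+)-H_t(t-)=\frac{\phi(\mu(t))}{\phi(\mu_0)}.$$
   Context: Data: $\lambda>0$; $F,F_0$ are cumulative distribution functions (CDFs) on $\mathbb{R}$ (offer distribution and residual price distribution); $X\sim F$, $X_0\sim F_0$; $y_+=\max(y,0)$; $\mu_0=E[X_0]$; $M=\sup\{x : F(x)<1\}\in(-\infty,+\infty]$. Standing assumptions: $E[X_+]<\infty$, $E[|X_0|]<\infty$, $0\le\mu_0<M$. Define $\phi(x)=\int_x^\infty[1-F(u)]\,du$ and $\Psi(x)=\int_{\mu_0}^x\frac{du}{\phi(u)}$ for $x\in[\mu_0,M)$. The optimal policy is the function $\mu:[0,\infty)\to[\mu_0,M)$, $\mu(t)=\Psi^{-1}(\lambda t)$; equivalently, the solution of $\mu'(t)=\lambda\phi(\mu(t))$, $\mu(0)=\mu_0$. Bidding process with marketing period $t\ge 0$ under the optimal policy: let $D_1,D_2,\dots$ be exponential with rate $\lambda$ (inter-arrival times of offers) and $X_1,X_2,\dots$ be distributed according to $F$ (offer values), all independent. The time remaining to the deadline when the $i$-th offer arrives is $t_i=\max(t_{i-1}-D_i,0)$, with initial value $t$ (that is, $t_i=(t-D_1-\dots-D_i)_+$). An offer $X_i$ with $t_i>0$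 is accepted if and only if $X_i\ge\mu(t_i)$; at the first accepted offer $i$ the process ends, with time to sale $T_t=t-t_i$. If no offer is accepted before the remaining time reaches $0$, then $T_t=t$. $H_t(t\pm)$ denote one-sided limits, with $H_t(t-)=0$ when $t=0$. *)

theory Defs
  imports "HOL-Probability.Probability"
begin

text \<open>
  The law of a random variable with CDF \<open>F\<close> is the library's \<open>interval_measure F\<close>: under \<open>is_cdf F\<close>
  it is the unique probability measure on the Borel sets of the line whose \<open>cdf\<close> is \<open>F\<close>.
\<close>

definition is_cdf :: "(real \<Rightarrow> real) \<Rightarrow> bool" where
  "is_cdf F \<longleftrightarrow> mono F \<and> (\<forall>x. continuous (at_right x) F) \<and>
     (F \<longlongrightarrow> 0) at_bot \<and> (F \<longlongrightarrow> 1) at_top"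

definition upper_end :: "(real \<Rightarrow> real) \<Rightarrow> ereal" where
  "upper_end F = Sup {ereal x | x. F x < 1}"

definition phi :: "(real \<Rightarrow> real) \<Rightarrow> real \<Rightarrow> real" where
  "phi F x = (LBINT u:{x..}. 1 - F u)"

text \<open>Only used for \<open>\<mu>0 \<le> x\<close> with \<open>x\<close> below \<open>upper_end F\<close>.\<close>

definition Psi :: "(real \<Rightarrow> real) \<Rightarrow> real \<Rightarrow> real \<Rightarrow> real" where
  "Psi F \<mu>0 x = (LBINT u:{\<mu>0..x}. 1 / phi F u)"

definition opt_policy :: "real \<Rightarrow> (real \<Rightarrow> real) \<Rightarrow> real \<Rightarrow> real \<Rightarrow> real" where
  "opt_policy l F \<mu>0 t =
     the_inv_into {x. \<mu>0 \<le> x \<and> ereal x < upper_end F} (Psi F \<mu>0) (l * t)"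

text \<open>
  Offers are numbered from 1; the values \<open>d 0\<close> and \<open>x 0\<close> of the sequences below are never used.
  The following functions describe a single sample path, with inter-arrival times \<open>d\<close>,
  offer values \<open>x\<close> and acceptance threshold \<open>m\<close> (a function of the time remaining).
\<close>

primrec time_left :: "real \<Rightarrow> (nat \<Rightarrow> real) \<Rightarrow> nat \<Rightarrow> real" where
  "time_left t d 0 = t"
| "time_left t d (Suc i) = max (time_left t d i - d (Suc i)) 0"

definition accepted ::
  "(real \<Rightarrow> real) \<Rightarrow> real \<Rightarrow> (nat \<Rightarrow> real) \<Rightarrow> (nat \<Rightarrow> real) \<Rightarrow> nat \<Rightarrow> bool" where
  "accepted m t d x i \<longleftrightarrow> 1 \<le> i \<and> 0 < time_left t d i \<and> m (time_left t d i) \<le> x i"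

definition time_to_sale ::
  "(real \<Rightarrow> real) \<Rightarrow> real \<Rightarrow> (nat \<Rightarrow> real) \<Rightarrow> (nat \<Rightarrow> real) \<Rightarrow> real" where
  "time_to_sale m t d x =
     (if \<exists>i. accepted m t d x i
      then t - time_left t d (LEAST i. accepted m t d x i)
      else t)"

end

theory Submission
  imports Defs
begin

text \<open>
  Fix \<open>0 \<le> r < t\<close> and put \<open>s = t - r\<close>. A sale takes place by time \<open>r\<close> iff some offer that arrives at a
  remaining time of at least \<open>s\<close> reaches the threshold, so the claim is that no such offer does with
  probability \<open>E t\<close>, where \<open>E v = \<phi> (\<mu> v) / \<phi> (\<mu> s)\<close> for \<open>v \<ge> s\<close> and \<open>E v = 1\<close> for \<open>v < s\<close>.

  The reason is a martingale. From remaining time \<open>u \<ge> s\<close>, the next offer comes after an exponential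
  delay \<open>d\<close>. Either \<open>u - d < s\<close>, and no sale can occur any more in the relevant period, or the offer is
  rejected with probability \<open>P (X < \<mu> (u - d))\<close> and the process restarts from \<open>u - d\<close>. The function \<open>E\<close>
  is invariant under this step (\<open>no_sale_prob_harmonic\<close>): since \<open>\<mu>' = l \<phi> (\<mu>)\<close> and
  \<open>\<phi>' = - (1 - F)\<close>, the function \<open>- exp (- l d) E (u - d)\<close> of \<open>d\<close> has derivative
  \<open>l exp (- l d) F (\<mu> (u - d)) E (u - d)\<close> (\<open>survival_flow_equation\<close>). Where \<open>F\<close> jumps
  at \<open>\<mu> v\<close>, \<open>\<phi>\<close> is not differentiable and \<open>F (\<mu> v)\<close> differs from \<open>P (X < \<mu> v)\<close>; but \<open>\<mu>\<close> is strictly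
  increasing, so this concerns countably many \<open>d\<close>, which a version of the fundamental theorem of
  calculus tolerates (\<open>fundamental_theorem_of_calculus_off_countable\<close>).

  Hence \<open>E\<close> of the remaining time after \<open>n\<close> offers, multiplied by the indicator that none of them was
  accepted at a remaining time of at least \<open>s\<close>, has the same expectation \<open>E t\<close> for every \<open>n\<close>
  (\<open>nn_integral_unsold\<close>). Almost surely the remaining time falls below \<open>s\<close>, so this bounded
  sequence converges to the indicator of no sale by time \<open>r\<close>, which gives the distribution function
  below \<open>t\<close> (\<open>prob_always_unsold\<close>). The mass at \<open>t\<close> is 1 minus the left limit of this function at \<open>t\<close>,
  found by continuity of \<open>\<phi>\<close> and \<open>\<mu>\<close>.

  That \<open>\<mu>\<close> exists for all times rests on the divergence of the integral of \<open>1 / \<phi>\<close> towards the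
  right end of the support of \<open>F\<close> (\<open>Psi_unbounded\<close>).
\<close>

section \<open>Calculus with countably many exceptional points\<close>

text \<open>
  Otherwise the uncountably many values strictly between \<open>f b\<close> and \<open>f a\<close> include a \<open>y\<close> that \<open>f\<close> does
  not take on the exceptional set \<open>S\<close>. At the last point \<open>c\<close> with \<open>f c = y\<close> the derivative is then
  positive, although \<open>f\<close> stays below \<open>y\<close> to the right of \<open>c\<close>.
\<close>
lemma le_endpoint_if_DERIV_pos_off_countable:
  fixes f :: "real \<Rightarrow> real"
  assumes "a \<le> b" "countable S" and cont: "continuous_on {a..b} f"
    and der: "\<And>x. x \<in> {a<..<b} - S \<Longrightarrow> \<exists>D>0. (f has_real_derivative D) (at x)"
  shows "f a \<le> f b"
proof (rule ccontr)
  assume "\<not> f a \<le> f b"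
  then have "uncountable ({f b<..<f a} - f ` S)"
    using \<open>countable S\<close> by (intro uncountable_minus_countable) (auto simp: uncountable_open_interval)
  then obtain y where y: "f b < y" "y < f a" "y \<notin> f ` S"
    by (metis Diff_iff countable_empty equals0I greaterThanLessThan_iff)
  define C where "C = {x \<in> {a..b}. y \<le> f x}"
  have "closed C"
    unfolding C_def using continuous_on_const cont
    by (rule continuous_on_closed_Collect_le) (rule closed_real_atLeastAtMost)
  then have "compact C"
    by (auto simp: compact_eq_bounded_closed C_def intro: bounded_subset[of "{a..b}"])
  moreover have "a \<in> C"
    using y \<open>a \<le> b\<close> by (auto simp: C_def)
  ultimately obtain c where c: "c \<in> C" "\<And>x. x \<in> C \<Longrightarrow> x \<le> c"
    using compact_attains_sup[of C] by auto
  have "c < b"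
    using c(1) y(1) by (cases "c = b") (auto simp: C_def)
  have above: "f x < y" if "c < x" "x \<le> b" for x
    using c(2)[of x] c(1) that by (auto simp: C_def not_less[symmetric])
  obtain x where x: "c \<le> x" "x \<le> b" "f x = y"
    using IVT2'[of f b y c] c(1) y(1) \<open>c < b\<close> cont continuous_on_subset[OF cont, of "{c..b}"]
    by (auto simp: C_def)
  then have "f c = y"
    using above[of x] by (cases "x = c") auto
  then have "c \<in> {a<..<b} - S"
    using y c(1) \<open>c < b\<close> by (cases "c = a") (auto simp: C_def)
  then obtain D where "D > 0" "(f has_real_derivative D) (at c)"
    using der by blast
  then obtain d where d: "d > 0" "\<And>h. 0 < h \<Longrightarrow> h < d \<Longrightarrow> f c < f (c + h)"
    using DERIV_pos_inc_right by blast
  define h where "h = min (d / 2) (b - c)"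
  have "0 < h" "h < d" "c + h \<le> b"
    using d(1) \<open>c < b\<close> by (auto simp: h_def)
  then show False
    using d(2)[of h] above[of "c + h"] \<open>f c = y\<close> by simp
qed

text \<open>
  The exceptional set must be allowed to be countable and not just finite, because below it comes
  from the jumps of a distribution function. The difference \<open>h\<close> of \<open>g\<close> and the indefinite integral of
  \<open>f\<close> has derivative 0 off \<open>S\<close>, so the preceding lemma applies to \<open>e * x + h x\<close> and to \<open>e * x - h x\<close>
  for every \<open>e > 0\<close>, and \<open>h\<close> is constant.
\<close>
lemma fundamental_theorem_of_calculus_off_countable:
  fixes f g :: "real \<Rightarrow> real"
  assumes "a \<le> b" "countable S" and f: "f integrable_on {a..b}"
    and g: "continuous_on {a..b} g"
    and der: "\<And>x. x \<in> {a<..<b} - S \<Longrightarrow> (g has_real_derivative f x) (at x)"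
    and fc: "\<And>x. x \<in> {a<..<b} - S \<Longrightarrow> isCont f x"
  shows "(f has_integral (g b - g a)) {a..b}"
proof -
  define W where "W x = integral {a..x} f" for x
  have W: "continuous_on {a..b} W"
    unfolding W_def by (rule indefinite_integral_continuous_1[OF f])
  have W': "(W has_real_derivative f x) (at x)" if "x \<in> {a<..<b} - S" for x
  proof -
    have "(W has_vector_derivative f x) (at x within ({a..b} - {}))"
      unfolding W_def using that fc[OF that]
      by (intro integral_has_vector_derivative_continuous_at[OF f])
         (auto intro: continuous_at_imp_continuous_at_within)
    then show ?thesis
      using that by (simp add: has_real_derivative_iff_has_vector_derivative at_within_Icc_at)
  qed
  have le: "\<bar>(g b - W b) - (g a - W a)\<bar> \<le> e * (b - a)" if "e > 0" for e
  proof -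
    have "(g a - W a) + e * a \<le> (g b - W b) + e * b"
    proof (rule le_endpoint_if_DERIV_pos_off_countable[OF assms(1,2)])
      show "\<exists>D>0. ((\<lambda>x. (g x - W x) + e * x) has_real_derivative D) (at x)"
        if "x \<in> {a<..<b} - S" for x
        using \<open>e > 0\<close> by (intro exI[of _ e]) (auto intro!: derivative_eq_intros der W' that)
    qed (intro continuous_intros g W)
    moreover have "- (g a - W a) + e * a \<le> - (g b - W b) + e * b"
    proof (rule le_endpoint_if_DERIV_pos_off_countable[OF assms(1,2)])
      show "\<exists>D>0. ((\<lambda>x. - (g x - W x) + e * x) has_real_derivative D) (at x)"
        if "x \<in> {a<..<b} - S" for x
        using \<open>e > 0\<close> by (intro exI[of _ e]) (auto intro!: derivative_eq_intros der W' that)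
    qed (intro continuous_intros g W)
    ultimately show ?thesis
      by (simp add: algebra_simps abs_le_iff)
  qed
  have "\<bar>(g b - W b) - (g a - W a)\<bar> \<le> 0"
  proof (rule field_le_epsilon)
    fix e :: real assume "e > 0"
    have "e / (b - a + 1) * (b - a) \<le> e"
      using \<open>e > 0\<close> \<open>a \<le> b\<close> by (simp add: field_simps)
    then show "\<bar>(g b - W b) - (g a - W a)\<bar> \<le> 0 + e"
      using le[of "e / (b - a + 1)"] \<open>e > 0\<close> \<open>a \<le> b\<close> by simp
  qed
  then have "g b - g a = integral {a..b} f"
    by (simp add: W_def)
  then show ?thesis
    using f by (simp add: integrable_integral)
qed

section \<open>The offer distribution and its expected excess\<close>

lemma (in real_distribution) measurable_emeasure_lessThan:
  assumes [measurable]: "m \<in> borel_measurable N"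
  shows "(\<lambda>v. emeasure M {..<m v}) \<in> borel_measurable N"
proof -
  have "{p \<in> space (N \<Otimes>\<^sub>M M). snd p < m (fst p)} \<in> sets (N \<Otimes>\<^sub>M M)"
    by measurable
  then have "(\<lambda>v. emeasure M (Pair v -` {p \<in> space (N \<Otimes>\<^sub>M M). snd p < m (fst p)})) \<in> borel_measurable N"
    by (rule measurable_emeasure_Pair)
  then show ?thesis
    by (rule measurable_cong[THEN iffD1, rotated])
       (auto simp: space_pair_measure intro!: arg_cong[where f="emeasure M"])
qed

locale offer_distribution =
  fixes F :: "real \<Rightarrow> real"
  assumes is_cdf: "is_cdf F"
    and integrable_positive_part: "integrable (interval_measure F) (\<lambda>x. max x 0)"
begin

lemma mono_F: "mono F"
  using is_cdf by (simp add: is_cdf_def)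

lemma measurable_F [measurable]: "F \<in> borel_measurable borel"
  by (rule borel_measurable_mono[OF mono_F])

sublocale law: real_distribution "interval_measure F"
  using is_cdf mono_F by (intro real_distribution_interval_measure) (auto simp: is_cdf_def mono_def)

lemma cdf_law: "cdf (interval_measure F) = F"
  using is_cdf mono_F
  by (auto simp: fun_eq_iff cdf_def is_cdf_def mono_def intro!: measure_interval_measure_Iic)

lemma F_nonneg: "0 \<le> F x" and F_le_1: "F x \<le> 1"
  using law.cdf_nonneg[of x] law.cdf_bounded_prob[of x] by (simp_all add: cdf_law)

lemma law_lessThan:
  assumes "isCont F x" shows "emeasure (interval_measure F) {..<x} = ennreal (F x)"
proof -
  have "(F \<longlongrightarrow> F x) (at_left x)"
    using assms by (auto simp: isCont_def intro: tendsto_within_subset)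
  moreover have "(F \<longlongrightarrow> measure (interval_measure F) {..<x}) (at_left x)"
    using law.cdf_at_left[of x] by (simp add: cdf_law)
  ultimately have "measure (interval_measure F) {..<x} = F x"
    by (rule tendsto_unique[OF trivial_limit_at_left_real, rotated])
  then show ?thesis
    by (simp add: law.emeasure_eq_measure)
qed

text \<open>
  By Tonelli, the integral of \<open>1 - F\<close> over \<open>{x..}\<close> is the expectation of the positive part of
  \<open>X - x\<close>, which is at most that of \<open>max X 0 + \<bar>x\<bar>\<close>.
\<close>
lemma set_integrable_survival: "set_integrable lborel {x..} (\<lambda>u. 1 - F u)"
proof -
  let ?\<nu> = "interval_measure F"
  interpret pair_sigma_finite lborel ?\<nu> ..
  have tail: "ennreal (1 - F u) = (\<integral>\<^sup>+y. indicator {u<..} y \<partial>?\<nu>)" for u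
  proof -
    have "1 - F u = measure ?\<nu> (space ?\<nu> - {..u})"
      using law.prob_compl[of "{..u}"] cdf_law by (simp add: cdf_def fun_eq_iff)
    also have "space ?\<nu> - {..u} = {u<..}"
      by auto
    finally show ?thesis
      by (simp add: law.emeasure_eq_measure)
  qed
  have "(\<integral>\<^sup>+u. ennreal (indicator {x..} u * (1 - F u)) \<partial>lborel) =
      (\<integral>\<^sup>+u. (\<integral>\<^sup>+y. indicator {x..} u * indicator {u<..} y \<partial>?\<nu>) \<partial>lborel)"
    by (intro nn_integral_cong) (auto simp: tail ennreal_mult split: split_indicator)
  also have "\<dots> = (\<integral>\<^sup>+y. (\<integral>\<^sup>+u. indicator {x..} u * indicator {u<..} y \<partial>lborel) \<partial>?\<nu>)"
  proof (rule Fubini'[symmetric])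
    have "(\<lambda>p. indicator {x..} (fst p) * indicator {p. fst p < snd p} p :: ennreal)
        \<in> borel_measurable (lborel \<Otimes>\<^sub>M ?\<nu>)"
      by measurable
    also have "(\<lambda>p. indicator {x..} (fst p) * indicator {p. fst p < snd p} p :: ennreal) =
        (\<lambda>(u, y). indicator {x..} u * indicator {u<..} y)"
      by (auto simp: fun_eq_iff split: split_indicator)
    finally show "(\<lambda>(u, y). indicator {x..} u * indicator {u<..} y :: ennreal)
        \<in> borel_measurable (lborel \<Otimes>\<^sub>M ?\<nu>)" .
  qed
  also have "\<dots> \<le> (\<integral>\<^sup>+y. ennreal (max y 0 + \<bar>x\<bar>) \<partial>?\<nu>)"
  proof (rule nn_integral_mono)
    fix y
    have "(\<integral>\<^sup>+u. indicator {x..} u * indicator {u<..} y \<partial>lborel) =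
        (\<integral>\<^sup>+u. indicator {x..<y} u \<partial>lborel)"
      by (intro nn_integral_cong) (auto split: split_indicator)
    also have "\<dots> \<le> ennreal (max y 0 + \<bar>x\<bar>)"
      by (cases "x \<le> y") (auto simp del: ennreal_plus intro!: ennreal_leI)
    finally show "(\<integral>\<^sup>+u. indicator {x..} u * indicator {u<..} y \<partial>lborel) \<le>
      ennreal (max y 0 + \<bar>x\<bar>)" .
  qed
  also have "\<dots> < \<infinity>"
  proof -
    have "integrable ?\<nu> (\<lambda>y. max y 0 + \<bar>x\<bar>)"
      by (intro Bochner_Integration.integrable_add integrable_positive_part law.integrable_const)
    then have "(\<integral>\<^sup>+y. ennreal (max y 0 + \<bar>x\<bar>) \<partial>?\<nu>) = ennreal (\<integral>y. max y 0 + \<bar>x\<bar> \<partial>?\<nu>)"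
      by (rule nn_integral_eq_integral) simp
    then show ?thesis
      by (simp only: ennreal_less_top infinity_ennreal_def)
  qed
  finally have "(\<integral>\<^sup>+u. ennreal (indicator {x..} u * (1 - F u)) \<partial>lborel) < \<infinity>" .
  then show ?thesis
    unfolding set_integrable_def real_scaleR_def
    by (intro integrableI_nonneg) (simp_all add: F_le_1)
qed

lemma survival_integrable_on: "(\<lambda>u. 1 - F u) integrable_on {x..y}"
  by (intro set_borel_integral_eq_integral(1) set_integrable_subset[OF set_integrable_survival[of x]]) auto

lemma phi_eq_add:
  assumes "x \<le> y" shows "phi F x = integral {x..y} (\<lambda>u. 1 - F u) + phi F y"
proof -
  have int: "set_integrable lborel {x..y} (\<lambda>u. 1 - F u)"
    by (intro set_integrable_subset[OF set_integrable_survival[of x]]) auto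
  have "phi F x = (LBINT u:{x..y} \<union> {y..}. 1 - F u)"
    unfolding phi_def using assms by (intro arg_cong[where f="\<lambda>S. set_lebesgue_integral lborel S _"]) auto
  also have "\<dots> = (LBINT u:{x..y}. 1 - F u) + (LBINT u:{y..}. 1 - F u)"
    by (intro set_integral_Un_AE int set_integrable_survival)
       (use AE_lborel_singleton[of y] in \<open>auto elim!: eventually_mono\<close>)
  finally show ?thesis
    using set_borel_integral_eq_integral(2)[OF int] by (simp add: phi_def)
qed

lemma phi_eq_diff: "x \<le> y \<Longrightarrow> phi F y = phi F x - integral {x..y} (\<lambda>u. 1 - F u)"
  using phi_eq_add[of x y] by simp

lemma phi_nonneg: "0 \<le> phi F x"
  unfolding phi_def set_lebesgue_integral_def by (intro integral_nonneg_AE) (auto simp: F_le_1)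

lemma phi_antimono: "x \<le> y \<Longrightarrow> phi F y \<le> phi F x"
  using phi_eq_add[of x y] by (auto simp: F_le_1 intro!: integral_nonneg survival_integrable_on)

lemma continuous_on_phi: "continuous_on S (phi F)"
proof (rule continuous_on_subset)
  show "continuous_on UNIV (phi F)"
  proof (rule continuous_at_imp_continuous_on, safe)
    fix x
    have "continuous_on {x-1..x+1} (\<lambda>y. phi F (x-1) - integral {x-1..y} (\<lambda>u. 1 - F u))"
      by (intro continuous_intros indefinite_integral_continuous_1 survival_integrable_on)
    then have "continuous_on {x-1..x+1} (phi F)"
      by (rule continuous_on_eq) (auto intro: phi_eq_diff[symmetric])
    then show "isCont (phi F) x"
      by (rule continuous_on_interior) auto
  qed
qed simp

lemma measurable_phi [measurable]: "phi F \<in> borel_measurable borel"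
  by (intro borel_measurable_continuous_onI continuous_on_phi)

lemma DERIV_phi:
  assumes "isCont F x" shows "(phi F has_real_derivative - (1 - F x)) (at x)"
proof -
  have "((\<lambda>y. integral {x-1..y} (\<lambda>u. 1 - F u)) has_vector_derivative (1 - F x))
      (at x within ({x-1..x+1} - {}))"
    using continuous_at_imp_continuous_at_within[OF assms]
    by (intro integral_has_vector_derivative_continuous_at survival_integrable_on continuous_intros) auto
  then have "((\<lambda>y. integral {x-1..y} (\<lambda>u. 1 - F u)) has_real_derivative (1 - F x)) (at x)"
    by (simp add: has_real_derivative_iff_has_vector_derivative at_within_Icc_at)
  then have "((\<lambda>y. phi F (x-1) - integral {x-1..y} (\<lambda>u. 1 - F u)) has_real_derivative - (1 - F x)) (at x)"
    by (auto intro!: derivative_eq_intros)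
  then show ?thesis
    by (rule has_field_derivative_transform_within_open[where S="{x-1<..<x+1}"])
       (auto intro: phi_eq_diff[symmetric])
qed

lemma phi_pos:
  assumes "ereal x < upper_end F" shows "0 < phi F x"
proof -
  obtain y where "x < y" "F y < 1"
    using assms by (auto simp: upper_end_def less_Sup_iff)
  have "0 < (y - x) * (1 - F y)"
    using \<open>x < y\<close> \<open>F y < 1\<close> by simp
  also have "\<dots> = integral {x..y} (\<lambda>_. 1 - F y)"
    using \<open>x < y\<close> by simp
  also have "\<dots> \<le> integral {x..y} (\<lambda>u. 1 - F u)"
    by (intro integral_le survival_integrable_on) (auto intro!: monoD[OF mono_F])
  also have "\<dots> \<le> phi F x"
    using phi_eq_add[of x y] phi_nonneg[of y] \<open>x < y\<close> by simp
  finally show ?thesis .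
qed

lemma F_eq_1:
  assumes "upper_end F < ereal x" shows "F x = 1"
proof (rule ccontr)
  assume "F x \<noteq> 1"
  then have "ereal x \<le> upper_end F"
    using F_le_1[of x] unfolding upper_end_def by (intro Sup_upper) (auto simp: less_le)
  then show False using assms by simp
qed

text \<open>
  This bound makes the integral of \<open>1 / phi F\<close> diverge at a finite right end of the support.
\<close>
lemma phi_le_distance:
  assumes "upper_end F = ereal m" "x \<le> m" shows "phi F x \<le> m - x"
proof -
  have "phi F m = (LBINT u:{m..}. 0)"
    unfolding phi_def set_lebesgue_integral_def
    by (intro integral_cong_AE)
      (use AE_lborel_singleton[of m] F_eq_1 assms in \<open>auto elim!: eventually_mono split: split_indicator\<close>)
  then have "phi F x = integral {x..m} (\<lambda>u. 1 - F u)"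
    using phi_eq_add[OF assms(2)] by simp
  also have "\<dots> \<le> integral {x..m} (\<lambda>_. 1)"
    by (intro integral_le survival_integrable_on) (auto simp: F_nonneg)
  finally show ?thesis
    using assms(2) by simp
qed

end

section \<open>The optimal policy\<close>

text \<open>
  The policy is studied through its inverse: \<open>Psi\<close> is an increasing bijection from \<open>[\<mu>0, upper_end F)\<close>
  to \<open>[0, \<infinity>)\<close> with derivative \<open>1 / phi F\<close>.
\<close>
locale optimal_policy = offer_distribution +
  fixes l \<mu>0 :: real
  assumes rate_pos: "0 < l" and start_below_end: "ereal \<mu>0 < upper_end F"
begin

definition policy_range :: "real set" where
  "policy_range = {x. \<mu>0 \<le> x \<and> ereal x < upper_end F}"

lemma policy_range_start: "\<mu>0 \<in> policy_range"
  using start_below_end by (simp add: policy_range_def)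

lemma policy_range_interval: "x \<le> y \<Longrightarrow> y \<in> policy_range \<Longrightarrow> {x..y} \<inter> {\<mu>0..} \<subseteq> policy_range"
  by (auto simp: policy_range_def intro: order.strict_trans1[of "ereal _" "ereal y"])

lemma phi_pos_on_policy_range: "x \<in> policy_range \<Longrightarrow> 0 < phi F x"
  by (simp add: policy_range_def phi_pos)

lemma continuous_on_inverse_phi:
  assumes "y \<in> policy_range" shows "continuous_on {\<mu>0..y} (\<lambda>u. 1 / phi F u)"
proof -
  have "phi F u \<noteq> 0" if "u \<in> {\<mu>0..y}" for u
    using phi_pos_on_policy_range[of u] policy_range_interval[of \<mu>0 y] assms that by (auto simp: policy_range_def)
  then show ?thesis
    by (intro continuous_intros continuous_on_phi) auto
qed

lemma Psi_eq_integral: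
  assumes "y \<in> policy_range" shows "Psi F \<mu>0 y = integral {\<mu>0..y} (\<lambda>u. 1 / phi F u)"
  unfolding Psi_def
  by (intro set_borel_integral_eq_integral(2) borel_integrable_atLeastAtMost'
      continuous_on_inverse_phi assms)

lemma Psi_start: "Psi F \<mu>0 \<mu>0 = 0"
  by (simp add: Psi_eq_integral policy_range_start)

lemma Psi_increment:
  assumes "x \<in> policy_range" "y \<in> policy_range" "x \<le> y"
  shows "Psi F \<mu>0 y - Psi F \<mu>0 x = integral {x..y} (\<lambda>u. 1 / phi F u)"
    and "(\<lambda>u. 1 / phi F u) integrable_on {x..y}"
proof -
  have int: "(\<lambda>u. 1 / phi F u) integrable_on {\<mu>0..y}"
    by (intro integrable_continuous_real continuous_on_inverse_phi assms)
  show "Psi F \<mu>0 y - Psi F \<mu>0 x = integral {x..y} (\<lambda>u. 1 / phi F u)"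
    using Henstock_Kurzweil_Integration.integral_combine[OF _ assms(3) int] assms(1,2)
    by (simp add: Psi_eq_integral policy_range_def)
  show "(\<lambda>u. 1 / phi F u) integrable_on {x..y}"
    using assms by (intro integrable_subinterval_real[OF int]) (auto simp: policy_range_def)
qed

lemma Psi_increment_ge:
  assumes "x \<in> policy_range" "y \<in> policy_range" "x \<le> y"
  shows "(y - x) / phi F \<mu>0 \<le> Psi F \<mu>0 y - Psi F \<mu>0 x"
proof -
  have "(y - x) / phi F \<mu>0 = integral {x..y} (\<lambda>u. 1 / phi F \<mu>0)"
    using assms(3) by simp
  also have "\<dots> \<le> integral {x..y} (\<lambda>u. 1 / phi F u)"
  proof (rule integral_le)
    fix u assume "u \<in> {x..y}"
    then have "u \<in> policy_range" "\<mu>0 \<le> u"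
      using assms policy_range_interval[OF assms(3,2)] by (auto simp: policy_range_def)
    then show "1 / phi F \<mu>0 \<le> 1 / phi F u"
      by (intro divide_left_mono phi_antimono mult_pos_pos phi_pos_on_policy_range policy_range_start) auto
  qed (use Psi_increment(2)[OF assms] in auto)
  finally show ?thesis
    by (simp add: Psi_increment(1)[OF assms])
qed

lemma Psi_strict_mono:
  assumes "x \<in> policy_range" "y \<in> policy_range" "x < y" shows "Psi F \<mu>0 x < Psi F \<mu>0 y"
proof -
  have "0 < (y - x) / phi F \<mu>0"
    using assms phi_pos_on_policy_range[OF policy_range_start] by simp
  then show ?thesis
    using Psi_increment_ge[of x y] assms by simp
qed

lemma Psi_inj: "inj_on (Psi F \<mu>0) policy_range"
  by (rule linorder_inj_onI') (use Psi_strict_mono in \<open>force simp: less_le\<close>)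

lemma Psi_continuous_on:
  assumes "y \<in> policy_range" shows "continuous_on {\<mu>0..y} (Psi F \<mu>0)"
proof -
  have "continuous_on {\<mu>0..y} (\<lambda>x. integral {\<mu>0..x} (\<lambda>u. 1 / phi F u))"
    by (intro indefinite_integral_continuous_1 integrable_continuous_real
        continuous_on_inverse_phi assms)
  then show ?thesis
    by (rule continuous_on_eq)
       (use assms policy_range_interval[of \<mu>0 y] in \<open>auto simp: Psi_eq_integral policy_range_def subset_eq\<close>)
qed

text \<open>
  The policy is defined for all times only because \<open>Psi\<close> attains arbitrarily large values. If the
  support of \<open>F\<close> is unbounded above, \<open>1 / phi F\<close> is bounded below by \<open>1 / phi F \<mu>0\<close>; if it ends at \<open>m\<close>,
  \<open>1 / phi F u\<close> is at least \<open>1 / (m - u)\<close>, whose integral diverges logarithmically.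
\<close>
lemma Psi_unbounded: "\<exists>x\<in>policy_range. y \<le> Psi F \<mu>0 x"
proof (cases "upper_end F")
  case PInf
  define x where "x = \<mu>0 + \<bar>y\<bar> * phi F \<mu>0"
  have "x \<in> policy_range"
    using PInf phi_nonneg by (simp add: policy_range_def x_def)
  moreover have "y \<le> Psi F \<mu>0 x"
    using Psi_increment_ge[OF policy_range_start \<open>x \<in> policy_range\<close>]
      phi_pos_on_policy_range[OF policy_range_start] phi_nonneg
    by (simp add: x_def Psi_start)
  ultimately show ?thesis by blast
next
  case (real m)
  \<comment> \<open>The point up to which \<open>1 / (m - u)\<close> integrates to exactly \<open>\<bar>y\<bar>\<close>.\<close>
  define x where "x = m - (m - \<mu>0) * exp (- \<bar>y\<bar>)"
  have "\<mu>0 < m"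
    using real start_below_end by simp
  have "(m - \<mu>0) * exp (- \<bar>y\<bar>) \<le> (m - \<mu>0) * 1"
    using \<open>\<mu>0 < m\<close> by (intro mult_left_mono) auto
  moreover have "0 < (m - \<mu>0) * exp (- \<bar>y\<bar>)"
    using \<open>\<mu>0 < m\<close> by simp
  ultimately have x: "\<mu>0 \<le> x" "x < m"
    unfolding x_def by simp_all
  then have "x \<in> policy_range"
    using real by (simp add: policy_range_def)
  have "((\<lambda>u. 1 / (m - u)) has_integral (- ln (m - x) - (- ln (m - \<mu>0)))) {\<mu>0..x}"
    using x by (intro fundamental_theorem_of_calculus)
      (auto intro!: derivative_eq_intros simp flip: has_real_derivative_iff_has_vector_derivative)
  moreover have "ln (m - x) = ln (m - \<mu>0) - \<bar>y\<bar>"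
    using \<open>\<mu>0 < m\<close> by (simp add: x_def ln_mult)
  ultimately have log: "((\<lambda>u. 1 / (m - u)) has_integral \<bar>y\<bar>) {\<mu>0..x}"
    by simp
  have "\<bar>y\<bar> \<le> integral {\<mu>0..x} (\<lambda>u. 1 / phi F u)"
  proof (rule has_integral_le[OF log integrable_integral])
    show "(\<lambda>u. 1 / phi F u) integrable_on {\<mu>0..x}"
      by (intro integrable_continuous_real continuous_on_inverse_phi \<open>x \<in> policy_range\<close>)
    fix u assume "u \<in> {\<mu>0..x}"
    then have "u \<in> policy_range" "u < m"
      using x real by (auto simp: policy_range_def)
    then show "1 / (m - u) \<le> 1 / phi F u"
      using phi_le_distance[OF real, of u] phi_pos_on_policy_range[of u] by (intro divide_left_mono) auto
  qed
  then have "y \<le> Psi F \<mu>0 x"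
    by (simp add: Psi_eq_integral \<open>x \<in> policy_range\<close>)
  with \<open>x \<in> policy_range\<close> show ?thesis ..
next
  case MInf
  then show ?thesis
    using start_below_end by simp
qed

abbreviation \<mu> :: "real \<Rightarrow> real" where
  "\<mu> \<equiv> opt_policy l F \<mu>0"

lemma policy_inverse:
  assumes "0 \<le> t" shows policy_in_range: "\<mu> t \<in> policy_range" and Psi_policy: "Psi F \<mu>0 (\<mu> t) = l * t"
proof -
  obtain x where x: "x \<in> policy_range" "l * t \<le> Psi F \<mu>0 x"
    using Psi_unbounded by blast
  have "\<mu>0 \<le> x"
    using x by (simp add: policy_range_def)
  have "0 \<le> l * t"
    using rate_pos assms by simp
  then obtain z where "\<mu>0 \<le> z" "z \<le> x" "Psi F \<mu>0 z = l * t"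
    using IVT'[of "Psi F \<mu>0" \<mu>0 "l * t" x] x(2) \<open>\<mu>0 \<le> x\<close> Psi_start Psi_continuous_on[OF x(1)] by auto
  then have "z \<in> policy_range" "l * t \<in> Psi F \<mu>0 ` policy_range"
    using policy_range_interval[OF \<open>\<mu>0 \<le> x\<close> x(1)] by force+
  then show "\<mu> t \<in> policy_range" "Psi F \<mu>0 (\<mu> t) = l * t"
    unfolding opt_policy_def policy_range_def[symmetric]
    using Psi_inj by (auto intro: f_the_inv_into_f the_inv_into_into)
qed

lemma policy_0: "\<mu> 0 = \<mu>0"
  using inj_onD[OF Psi_inj _ policy_in_range[of 0] policy_range_start] Psi_policy[of 0] Psi_start by simp

lemma policy_strict_mono:
  assumes "0 \<le> s" "s < t" shows "\<mu> s < \<mu> t"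
proof (rule ccontr)
  assume "\<not> \<mu> s < \<mu> t"
  then have "Psi F \<mu>0 (\<mu> t) \<le> Psi F \<mu>0 (\<mu> s)"
    using Psi_strict_mono[OF policy_in_range[of t] policy_in_range[of s]] assms by (cases "\<mu> s = \<mu> t") auto
  then show False
    using assms rate_pos by (simp add: Psi_policy)
qed

lemma policy_mono: "0 \<le> s \<Longrightarrow> s \<le> t \<Longrightarrow> \<mu> s \<le> \<mu> t"
  using policy_strict_mono[of s t] by (cases "s = t") auto

text \<open>
  Since \<open>phi F\<close> is at most \<open>phi F \<mu>0\<close> on the range of the policy, \<open>Psi\<close> grows at rate at least
  \<open>1 / phi F \<mu>0\<close>. This gives the continuity that the rule for the derivative of an inverse
  function asks for.
\<close>
lemma policy_lipschitz: "(l * phi F \<mu>0)-lipschitz_on {0..} \<mu>"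
proof -
  have *: "\<mu> t - \<mu> s \<le> l * phi F \<mu>0 * (t - s)" if "0 \<le> s" "s \<le> t" for s t
  proof -
    have "(\<mu> t - \<mu> s) / phi F \<mu>0 \<le> l * t - l * s"
      using Psi_increment_ge[OF policy_in_range[of s] policy_in_range[of t]] policy_mono[of s t] that
      by (simp add: Psi_policy)
    then show ?thesis
      using phi_pos_on_policy_range[OF policy_range_start] by (simp add: field_simps)
  qed
  show ?thesis
  proof (rule lipschitz_onI)
    fix s t :: real assume "s \<in> {0..}" "t \<in> {0..}"
    then show "dist (\<mu> s) (\<mu> t) \<le> l * phi F \<mu>0 * dist s t"
      using *[of s t] *[of t s] policy_mono[of s t] policy_mono[of t s]
      by (cases "s \<le> t") (auto simp: dist_real_def)
  qed (use rate_pos phi_nonneg in auto)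
qed

lemma policy_continuous_on: "continuous_on {0..} \<mu>"
  by (rule lipschitz_on_continuous_on[OF policy_lipschitz])

lemma DERIV_policy:
  assumes "0 < t" shows "(\<mu> has_real_derivative l * phi F (\<mu> t)) (at t)"
proof -
  have lt: "\<mu>0 < \<mu> t" "\<mu> t < \<mu> (t + 1)"
    using policy_strict_mono[of 0 t] policy_strict_mono[of t "t+1"] assms by (auto simp: policy_0)
  have next_in_range: "\<mu> (t + 1) \<in> policy_range"
    using assms by (simp add: policy_in_range)
  have "((\<lambda>x. integral {\<mu>0..x} (\<lambda>u. 1 / phi F u)) has_real_derivative 1 / phi F (\<mu> t))
      (at (\<mu> t) within {\<mu>0..\<mu> (t + 1)})"
    using lt by (intro integral_has_real_derivative continuous_on_inverse_phi next_in_range) auto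
  then have "((\<lambda>x. integral {\<mu>0..x} (\<lambda>u. 1 / phi F u)) has_real_derivative 1 / phi F (\<mu> t)) (at (\<mu> t))"
    using lt by (simp add: at_within_Icc_at)
  then have "(Psi F \<mu>0 has_real_derivative 1 / phi F (\<mu> t)) (at (\<mu> t))"
  proof (rule has_field_derivative_transform_within_open[where S="{\<mu>0<..<\<mu> (t + 1)}"])
    fix x assume "x \<in> {\<mu>0<..<\<mu> (t + 1)}"
    then have "x \<in> policy_range"
      using policy_range_interval[of \<mu>0 "\<mu> (t + 1)"] next_in_range by auto
    then show "integral {\<mu>0..x} (\<lambda>u. 1 / phi F u) = Psi F \<mu>0 x"
      by (simp add: Psi_eq_integral)
  qed (use lt in auto)
  then have "((\<lambda>x. Psi F \<mu>0 x / l) has_real_derivative 1 / phi F (\<mu> t) / l) (at (\<mu> t))"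
    by (rule DERIV_cdivide)
  then have "(\<mu> has_real_derivative inverse (1 / phi F (\<mu> t) / l)) (at t)"
  proof (rule DERIV_inverse_function[where a=0 and b="t+1"])
    show "isCont \<mu> t"
      using continuous_on_interior[OF policy_continuous_on, of t] assms by (simp add: interior_real_atLeast)
    show "1 / phi F (\<mu> t) / l \<noteq> 0"
      using phi_pos_on_policy_range[OF policy_in_range[of t]] rate_pos assms by simp
  qed (use assms rate_pos in \<open>auto simp: Psi_policy\<close>)
  then show ?thesis
    by (simp add: mult.commute)
qed

section \<open>The probability of no sale along the policy\<close>

text \<open>
  On negative arguments the policy has no meaning; holding it constant there makes it monotone on the whole
  line, hence Borel measurable.
\<close>
definition extended_policy :: "real \<Rightarrow> real" where
  "extended_policy v = \<mu> (max v 0)"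

lemma extended_policy_eq: "0 \<le> v \<Longrightarrow> extended_policy v = \<mu> v"
  by (simp add: extended_policy_def)

lemma mono_extended_policy: "mono extended_policy"
  by (auto intro!: monoI policy_mono simp: extended_policy_def)

lemma measurable_extended_policy [measurable]: "extended_policy \<in> borel_measurable borel"
  by (rule borel_measurable_mono[OF mono_extended_policy])

text \<open>
  The policy is injective, so it meets the countably many jumps of \<open>F\<close> at countably many times.
\<close>
lemma countable_policy_discontinuities: "countable {d \<in> {..u}. \<not> isCont F (\<mu> (u - d))}"
  (is "countable ?S")
proof (rule countable_image_inj_on)
  have "(\<lambda>d. \<mu> (u - d)) ` ?S \<subseteq> {x. \<not> isCont F x}"
    by auto
  then show "countable ((\<lambda>d. \<mu> (u - d)) ` ?S)"
    by (rule countable_subset) (rule mono_ctble_discont[OF mono_F])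
  show "inj_on (\<lambda>d. \<mu> (u - d)) ?S"
  proof (rule linorder_inj_onI')
    fix d d' assume "d \<in> ?S" "d' \<in> ?S" "d < d'"
    then show "\<mu> (u - d) \<noteq> \<mu> (u - d')"
      using policy_strict_mono[of "u - d'" "u - d"] by auto
  qed
qed

text \<open>
  Along the policy, \<open>phi F\<close> decreases at rate \<open>l * (1 - F)\<close> relative to its value: by the chain rule,
  the derivative of \<open>\<lambda>v. phi F (\<mu> v)\<close> at \<open>v\<close> is \<open>- (1 - F (\<mu> v)) * l * phi F (\<mu> v)\<close>. Multiplied by
  \<open>- exp (- l * d)\<close> with \<open>v = u - d\<close>, the term without \<open>F\<close> cancels, so
  \<open>- exp (- l * d) * phi F (\<mu> (u - d))\<close> is an antiderivative of the integrand. This holds only where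
  \<open>F\<close> is continuous at \<open>\<mu> (u - d)\<close>, that is, off a countable set.
\<close>
lemma survival_flow_equation:
  assumes "0 \<le> s" "s \<le> u"
  shows "((\<lambda>d. l * exp (- l * d) * (F (\<mu> (u - d)) * phi F (\<mu> (u - d)))) has_integral
    phi F (\<mu> u) - exp (- l * (u - s)) * phi F (\<mu> s)) {0..u - s}"
proof -
  let ?E = "\<lambda>v. phi F (\<mu> v)"
  let ?f = "\<lambda>d. l * exp (- l * d) * (F (\<mu> (u - d)) * ?E (u - d))"
  let ?g = "\<lambda>d. l * exp (- l * d) * (F (extended_policy (u - d)) * phi F (extended_policy (u - d)))"
  define S where "S = {d \<in> {..u}. \<not> isCont F (\<mu> (u - d))}"
  have "countable S"
    unfolding S_def by (rule countable_policy_discontinuities)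
  have cont: "continuous_on {0..u - s} (\<lambda>d. \<mu> (u - d))"
    by (rule continuous_on_compose2[OF policy_continuous_on]) (use assms in \<open>auto intro!: continuous_intros\<close>)
  have "(?f has_integral (- exp (- l * (u - s)) * ?E (u - (u - s)) - (- exp (- l * 0) * ?E (u - 0)))) {0..u - s}"
  proof (rule fundamental_theorem_of_calculus_off_countable[OF _ \<open>countable S\<close>])
    have "set_integrable lborel {0..u - s} ?g"
    proof (rule set_integrable_bound)
      show "set_integrable lborel {0..u - s} (\<lambda>d. l * (1 * phi F (extended_policy 0)))"
        by (intro borel_integrable_atLeastAtMost' continuous_intros)
      show "set_borel_measurable lborel {0..u - s}
          ?g"
        unfolding set_borel_measurable_def by measurable
      show "AE d in lborel. d \<in> {0..u - s} \<longrightarrow>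
          norm (?g d) \<le> norm (l * (1 * phi F (extended_policy 0)))"
      proof (intro AE_I2 impI)
        fix d assume "d \<in> {0..u - s}"
        then have "?g d \<le> l * 1 * (1 * phi F (extended_policy 0))"
          using rate_pos assms
          by (intro mult_mono phi_antimono mult_nonneg_nonneg monoD[OF mono_extended_policy]
              phi_nonneg F_nonneg F_le_1) auto
        then show "norm (?g d) \<le> norm (l * (1 * phi F (extended_policy 0)))"
          using rate_pos by (simp add: abs_mult phi_nonneg F_nonneg)
      qed
    qed
    then have "?g integrable_on {0..u - s}"
      by (rule set_borel_integral_eq_integral(1))
    then show "?f integrable_on {0..u - s}"
      by (rule integrable_eq) (use assms in \<open>simp add: extended_policy_def max_absorb1\<close>)
    show "continuous_on {0..u - s} (\<lambda>d. - exp (- l * d) * ?E (u - d))"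
      by (intro continuous_intros continuous_on_compose2[OF continuous_on_phi[of UNIV] cont]) auto
    fix d assume d: "d \<in> {0<..<u - s} - S"
    then have F: "isCont F (\<mu> (u - d))" and "0 < u - d"
      using assms by (auto simp: S_def)
    have "((\<lambda>d. \<mu> (u - d)) has_real_derivative (l * ?E (u - d)) * (- 1)) (at d)"
      by (rule DERIV_chain2[where f=\<mu> and g="\<lambda>d. u - d", OF DERIV_policy[OF \<open>0 < u - d\<close>]])
        (auto intro!: derivative_eq_intros)
    note \<mu>d = this
    have Ed: "((\<lambda>d. ?E (u - d)) has_real_derivative
        - (1 - F (\<mu> (u - d))) * ((l * ?E (u - d)) * (- 1))) (at d)"
      by (rule DERIV_chain2[where f="phi F" and g="\<lambda>d. \<mu> (u - d)", OF DERIV_phi[OF F] \<mu>d])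
    show "((\<lambda>d. - exp (- l * d) * ?E (u - d)) has_real_derivative ?f d) (at d)"
      by (rule derivative_eq_intros Ed refl)+ (simp add: algebra_simps)
    show "isCont ?f d"
      using isCont_o2[OF DERIV_isCont[OF \<mu>d] F] DERIV_isCont[OF Ed] by (intro continuous_intros) auto
  qed (use assms in auto)
  then show ?thesis
    by simp
qed

text \<open>
  With remaining time \<open>v\<close>, the probability that no offer arriving at a remaining time of at least
  \<open>s\<close> is accepted; the lemmas below lead to this interpretation.
\<close>
definition no_sale_prob :: "real \<Rightarrow> real \<Rightarrow> real" where
  "no_sale_prob s v = (if v < s then 1 else phi F (\<mu> v) / phi F (\<mu> s))"

lemma measurable_no_sale_prob [measurable]:
  assumes "0 \<le> s" shows "no_sale_prob s \<in> borel_measurable borel"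
proof -
  have "no_sale_prob s = (\<lambda>v. if v < s then 1 else phi F (extended_policy v) / phi F (\<mu> s))"
    using assms by (auto simp: no_sale_prob_def extended_policy_eq fun_eq_iff)
  then show ?thesis
    by simp
qed

lemma no_sale_prob_bounds:
  assumes "0 \<le> s" shows "0 \<le> no_sale_prob s v" "no_sale_prob s v \<le> 1"
  using assms phi_pos_on_policy_range[OF policy_in_range[of s]] phi_antimono[OF policy_mono[of s v]]
  by (auto simp: no_sale_prob_def phi_nonneg field_simps)

lemma emeasure_exponential_tail:
  assumes "0 \<le> a"
  shows "emeasure (density lborel (exponential_density l)) {a<..} = ennreal (exp (- l * a))"
proof -
  let ?M = "density lborel (exponential_density l)"
  interpret M: prob_space ?M
    by (rule prob_space_exponential_density[OF rate_pos])
  have "distributed ?M lborel (\<lambda>x. x) (exponential_density l)"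
    by (auto simp: distributed_def distr_id2)
  from M.exponential_distributedD_gt[OF this assms rate_pos] show ?thesis
    by (simp add: M.emeasure_eq_measure greaterThan_def mult.commute)
qed

text \<open>
  Conditioning on the next offer. If it arrives after a delay \<open>d\<close>, at remaining time \<open>v = u - d\<close> not
  below \<open>s\<close>, it is rejected with probability \<open>P (X < \<mu> v)\<close> and the process starts afresh from \<open>v\<close>; if
  it arrives later than that, no later offer counts either. The second case has probability
  \<open>exp (- l * (u - s))\<close>, which is the boundary term in \<open>survival_flow_equation\<close>. There \<open>F (\<mu> v)\<close>
  takes the place of \<open>P (X < \<mu> v)\<close>; the two agree unless \<open>F\<close> jumps at \<open>\<mu> v\<close>, so for almost every \<open>d\<close>.
\<close>
lemma no_sale_prob_harmonic:
  assumes "0 < s" "0 \<le> u"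
  shows "(\<integral>\<^sup>+d. (let v = max (u - d) 0 in
      (if s \<le> v then emeasure (interval_measure F) {..<extended_policy v} else 1) * ennreal (no_sale_prob s v))
      \<partial>density lborel (exponential_density l)) = ennreal (no_sale_prob s u)"
    (is "(\<integral>\<^sup>+d. ?w d \<partial>?M) = _")
proof -
  interpret M: prob_space ?M
    by (rule prob_space_exponential_density[OF rate_pos])
  note law.measurable_emeasure_lessThan [measurable]
  have [measurable]: "no_sale_prob s \<in> borel_measurable borel"
    using assms by simp
  have pos: "AE d in ?M. 0 \<le> d"
    by (subst AE_density) (auto simp: exponential_density_def)
  show ?thesis
  proof (cases "u < s")
    case True
    have "(\<integral>\<^sup>+d. ?w d \<partial>?M) = (\<integral>\<^sup>+d. 1 \<partial>?M)"
      using pos True assms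
      by (intro nn_integral_cong_AE) (auto elim!: eventually_mono simp: no_sale_prob_def Let_def)
    then show ?thesis
      using True M.emeasure_space_1 by (simp add: no_sale_prob_def)
  next
    case False
    let ?c = "phi F (\<mu> s)"
    let ?f = "\<lambda>d. l * exp (- l * d) * (F (extended_policy (u - d)) * phi F (extended_policy (u - d))) / ?c"
    have c: "0 < ?c"
      using assms by (simp add: phi_pos_on_policy_range policy_in_range)
    have cont: "AE d in lborel. d \<le> u \<longrightarrow> isCont F (\<mu> (u - d))"
      using AE_not_in[OF countable_imp_null_set_lborel[OF countable_policy_discontinuities[of u]]]
      by (auto elim!: eventually_mono)
    have "(\<integral>\<^sup>+d. ?w d \<partial>?M) = (\<integral>\<^sup>+d. ?w d * indicator {..u - s} d + indicator {u - s<..} d \<partial>?M)"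
      using assms False
      by (intro nn_integral_cong) (auto simp: no_sale_prob_def Let_def split: split_indicator)
    also have "\<dots> = (\<integral>\<^sup>+d. ?w d * indicator {..u - s} d \<partial>?M) + exp (- l * (u - s))"
      using False emeasure_exponential_tail[of "u - s"]
      by (subst nn_integral_add) (simp_all add: Let_def)
    also have "(\<integral>\<^sup>+d. ?w d * indicator {..u - s} d \<partial>?M) =
        (\<integral>\<^sup>+d. ennreal (exponential_density l d) * (?w d * indicator {..u - s} d) \<partial>lborel)"
      by (subst nn_integral_density) (simp_all add: Let_def)
    also have "\<dots> = (\<integral>\<^sup>+d. ennreal (indicator {0..u - s} d * ?f d) \<partial>lborel)"
    proof (rule nn_integral_cong_AE)
      show "AE d in lborel. ennreal (exponential_density l d) * (?w d * indicator {..u - s} d) =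
          ennreal (indicator {0..u - s} d * ?f d)"
        using cont
      proof eventually_elim
        case (elim d)
        show ?case
        proof (cases "d \<in> {0..u - s}")
          case True
          then have "?w d = ennreal (F (\<mu> (u - d)) * (phi F (\<mu> (u - d)) / ?c))"
            using elim assms c
            by (simp add: Let_def max_absorb1 law_lessThan extended_policy_eq no_sale_prob_def
                F_nonneg phi_nonneg flip: ennreal_mult)
          then show ?thesis
            using True assms c rate_pos
            by (simp add: exponential_density_def extended_policy_eq F_nonneg phi_nonneg mult_ac flip: ennreal_mult)
        next
          case False
          then show ?thesis
            by (auto simp: exponential_density_def split: split_indicator)
        qed
      qed
    qed
    also have "\<dots> = ennreal ((phi F (\<mu> u) - exp (- l * (u - s)) * ?c) / ?c)"
    proof (rule nn_integral_has_integral_lborel)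
      have "((\<lambda>d. l * exp (- l * d) * (F (\<mu> (u - d)) * phi F (\<mu> (u - d)))) has_integral
          phi F (\<mu> u) - exp (- l * (u - s)) * ?c) {0..u - s}"
        using assms False by (intro survival_flow_equation) auto
      then have "(?f has_integral (phi F (\<mu> u) - exp (- l * (u - s)) * ?c) / ?c) {0..u - s}"
        by (intro has_integral_divide) (rule has_integral_eq[rotated], use assms in \<open>auto simp: extended_policy_eq\<close>)
      then show "((\<lambda>d. indicator {0..u - s} d * ?f d) has_integral
          (phi F (\<mu> u) - exp (- l * (u - s)) * ?c) / ?c) UNIV"
        by (subst (asm) has_integral_restrict_UNIV[symmetric])
           (erule has_integral_eq[rotated], auto simp: indicator_def)
    qed (use rate_pos in \<open>auto simp: F_nonneg phi_nonneg\<close>)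
    also have "ennreal ((phi F (\<mu> u) - exp (- l * (u - s)) * ?c) / ?c) + ennreal (exp (- l * (u - s))) =
        ennreal (phi F (\<mu> u) / ?c)"
    proof (subst ennreal_plus[symmetric])
      have "exp (- l * (u - s)) * ?c \<le> phi F (\<mu> u)"
        using has_integral_nonneg[OF survival_flow_equation[of s u]] assms False rate_pos
        by (force simp: F_nonneg phi_nonneg)
      then show "0 \<le> (phi F (\<mu> u) - exp (- l * (u - s)) * ?c) / ?c"
        using c by simp
    qed (use c in \<open>simp_all add: field_simps\<close>)
    finally show ?thesis
      using False by (simp add: no_sale_prob_def)
  qed
qed

end

section \<open>Sample paths\<close>

lemma time_left_nonneg: "0 \<le> t \<Longrightarrow> 0 \<le> time_left t d i"
  by (cases i) auto

lemma time_left_cong: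
  "(\<And>i. 1 \<le> i \<Longrightarrow> i \<le> n \<Longrightarrow> d i = d' i) \<Longrightarrow> time_left t d n = time_left t d' n"
  by (induction n) auto

lemma time_left_antimono:
  assumes "\<And>i. 1 \<le> i \<Longrightarrow> 0 \<le> d i" "0 \<le> t" "i \<le> j"
  shows "time_left t d j \<le> time_left t d i"
proof (rule lift_Suc_antimono_le[OF _ \<open>i \<le> j\<close>])
  show "time_left t d (Suc n) \<le> time_left t d n" for n
    using assms(1)[of "Suc n"] time_left_nonneg[OF \<open>0 \<le> t\<close>, of d n] by simp
qed

lemma measurable_time_left [measurable (raw)]:
  assumes "\<And>i. 1 \<le> i \<Longrightarrow> i \<le> n \<Longrightarrow> (\<lambda>\<omega>. d \<omega> i) \<in> borel_measurable N"
  shows "(\<lambda>\<omega>. time_left t (d \<omega>) n) \<in> borel_measurable N"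
  using assms
proof (induction n)
  case (Suc n)
  have [measurable]: "(\<lambda>\<omega>. time_left t (d \<omega>) n) \<in> borel_measurable N"
    "(\<lambda>\<omega>. d \<omega> (Suc n)) \<in> borel_measurable N"
    using Suc by auto
  show ?case by simp
qed simp

text \<open>
  Only offers at a remaining time of at least \<open>s\<close> count: those are the offers whose acceptance makes
  the time to sale at most \<open>t - s\<close>.
\<close>
definition unsold :: "(real \<Rightarrow> real) \<Rightarrow> real \<Rightarrow> real \<Rightarrow> (nat \<Rightarrow> real) \<Rightarrow> (nat \<Rightarrow> real) \<Rightarrow> nat \<Rightarrow> bool" where
  "unsold m s t d x n \<longleftrightarrow> (\<forall>i\<in>{1..n}. s \<le> time_left t d i \<longrightarrow> x i < m (time_left t d i))"

lemma unsold_0 [simp]: "unsold m s t d x 0"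
  by (simp add: unsold_def)

lemma unsold_Suc:
  "unsold m s t d x (Suc n) \<longleftrightarrow> unsold m s t d x n \<and>
     (s \<le> time_left t d (Suc n) \<longrightarrow> x (Suc n) < m (time_left t d (Suc n)))"
  unfolding unsold_def by (simp add: atLeastAtMostSuc_conv del: time_left.simps) blast

lemma unsold_cong:
  assumes "\<And>i. 1 \<le> i \<Longrightarrow> i \<le> n \<Longrightarrow> d i = d' i" "\<And>i. 1 \<le> i \<Longrightarrow> i \<le> n \<Longrightarrow> x i = x' i"
  shows "unsold m s t d x n \<longleftrightarrow> unsold m s t d' x' n"
proof -
  have "time_left t d i = time_left t d' i" if "i \<le> n" for i
    using assms(1) that by (intro time_left_cong) auto
  then show ?thesis
    using assms(2) by (auto simp: unsold_def)
qed

lemma measurable_unsold [measurable (raw)]: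
  assumes [measurable]: "m \<in> borel_measurable borel"
    and d: "\<And>i. 1 \<le> i \<Longrightarrow> i \<le> n \<Longrightarrow> (\<lambda>\<omega>. d \<omega> i) \<in> borel_measurable N"
    and x: "\<And>i. 1 \<le> i \<Longrightarrow> i \<le> n \<Longrightarrow> (\<lambda>\<omega>. x \<omega> i) \<in> borel_measurable N"
  shows "Measurable.pred N (\<lambda>\<omega>. unsold m s t (d \<omega>) (x \<omega>) n)"
  unfolding unsold_def
proof (rule pred_intros_finite)
  fix i assume "i \<in> {1..n}"
  then have [measurable]: "(\<lambda>\<omega>. x \<omega> i) \<in> borel_measurable N"
    "(\<lambda>\<omega>. time_left t (d \<omega>) i) \<in> borel_measurable N"
    using x d by (auto intro!: measurable_time_left)
  show "Measurable.pred N (\<lambda>\<omega>. s \<le> time_left t (d \<omega>) i \<longrightarrow> x \<omega> i < m (time_left t (d \<omega>) i))"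
    by measurable
qed simp

text \<open>
  The remaining time never increases, so once it is below \<open>s\<close> no later offer counts.
\<close>
lemma unsold_stabilizes:
  assumes d: "\<And>i. 1 \<le> i \<Longrightarrow> 0 \<le> d i" and "0 \<le> t" and n: "time_left t d n < s"
  shows "unsold m s t d x n \<longleftrightarrow> (\<forall>k. unsold m s t d x k)"
proof
  assume "unsold m s t d x n"
  moreover have "time_left t d i < s" if "n < i" for i
  proof -
    have "time_left t d i \<le> time_left t d n"
      using d \<open>0 \<le> t\<close> that by (intro time_left_antimono) auto
    then show ?thesis
      using n by simp
  qed
  ultimately show "\<forall>k. unsold m s t d x k"
    unfolding unsold_def by (meson atLeastAtMost_iff not_less)
qed blast

lemma time_to_sale_cong:
  assumes "\<And>v. 0 < v \<Longrightarrow> m v = m' v"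
  shows "time_to_sale m t d x = time_to_sale m' t d x"
proof -
  have "accepted m t d x = accepted m' t d x"
    using assms by (auto simp: accepted_def fun_eq_iff)
  then show ?thesis
    by (simp add: time_to_sale_def)
qed

lemma time_to_sale_le: "time_to_sale m t d x \<le> t"
proof (cases "\<exists>i. accepted m t d x i")
  case True
  then have "accepted m t d x (LEAST i. accepted m t d x i)"
    by (rule LeastI_ex)
  then have "0 < time_left t d (LEAST i. accepted m t d x i)"
    by (simp add: accepted_def)
  then show ?thesis
    using True by (simp add: time_to_sale_def)
qed (simp add: time_to_sale_def)

lemma measurable_time_to_sale:
  assumes [measurable]: "m \<in> borel_measurable borel"
    and d: "\<And>i. 1 \<le> i \<Longrightarrow> (\<lambda>\<omega>. d \<omega> i) \<in> borel_measurable N"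
    and x: "\<And>i. 1 \<le> i \<Longrightarrow> (\<lambda>\<omega>. x \<omega> i) \<in> borel_measurable N"
  shows "(\<lambda>\<omega>. time_to_sale m t (d \<omega>) (x \<omega>)) \<in> borel_measurable N"
proof -
  have \<tau> [measurable]: "(\<lambda>\<omega>. time_left t (d \<omega>) i) \<in> borel_measurable N" for i
    using d by (auto intro!: measurable_time_left)
  have acc [measurable]: "Measurable.pred N (\<lambda>\<omega>. accepted m t (d \<omega>) (x \<omega>) i)" for i
  proof (cases "1 \<le> i")
    case True
    then have [measurable]: "(\<lambda>\<omega>. x \<omega> i) \<in> borel_measurable N"
      by (rule x)
    show ?thesis
      unfolding accepted_def by measurable
  qed (simp add: accepted_def)
  have "(\<lambda>\<omega>. LEAST i. accepted m t (d \<omega>) (x \<omega>) i) \<in> measurable N (count_space UNIV)"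
    by measurable
  then have [measurable]: "(\<lambda>\<omega>. time_left t (d \<omega>) (LEAST i. accepted m t (d \<omega>) (x \<omega>) i)) \<in> borel_measurable N"
    by (rule measurable_compose_countable[OF \<tau>])
  show ?thesis
    unfolding time_to_sale_def by measurable
qed

lemma time_to_sale_le_iff:
  assumes d: "\<And>i. 1 \<le> i \<Longrightarrow> 0 \<le> d i" and "0 \<le> t" and "0 < s"
  shows "time_to_sale m t d x \<le> t - s \<longleftrightarrow> \<not> (\<forall>n. unsold m s t d x n)"
proof
  assume le: "time_to_sale m t d x \<le> t - s"
  define i where "i = (LEAST i. accepted m t d x i)"
  have ex: "\<exists>i. accepted m t d x i"
    using le \<open>0 < s\<close> by (auto simp: time_to_sale_def split: if_splits)
  then have "accepted m t d x i" "s \<le> time_left t d i"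
    using le unfolding i_def by (auto simp: time_to_sale_def intro: LeastI_ex)
  then have "\<not> unsold m s t d x i"
    by (auto simp: accepted_def unsold_def not_less intro!: bexI[of _ i])
  then show "\<not> (\<forall>n. unsold m s t d x n)" by blast
next
  assume "\<not> (\<forall>n. unsold m s t d x n)"
  then obtain i where i: "1 \<le> i" "s \<le> time_left t d i" "m (time_left t d i) \<le> x i"
    by (auto simp: unsold_def not_less)
  then have acc: "accepted m t d x i"
    using \<open>0 < s\<close> by (simp add: accepted_def)
  then have "(LEAST i. accepted m t d x i) \<le> i"
    by (rule Least_le)
  then have "time_left t d i \<le> time_left t d (LEAST i. accepted m t d x i)"
    using d \<open>0 \<le> t\<close> by (intro time_left_antimono) auto
  then have "s \<le> time_left t d (LEAST i. accepted m t d x i)"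
    using i(2) by simp
  then show "time_to_sale m t d x \<le> t - s"
    using acc by (auto simp: time_to_sale_def)
qed

section \<open>Independent gaps and offers\<close>

text \<open>
  Conditional expectation given some members of an independent family: a further member
  can be integrated out under its own law, with the given ones held fixed.
\<close>
lemma (in prob_space) nn_integral_fresh_variable:
  assumes ind: "indep_vars M' Z I" and A: "A \<subseteq> I" "j \<in> I" "j \<notin> A"
    and h [measurable]: "h \<in> borel_measurable (PiM A M' \<Otimes>\<^sub>M M' j)"
  shows "(\<integral>\<^sup>+\<omega>. h (restrict (\<lambda>i. Z i \<omega>) A, Z j \<omega>) \<partial>M) =
    (\<integral>\<^sup>+\<omega>. (\<integral>\<^sup>+y. h (restrict (\<lambda>i. Z i \<omega>) A, y) \<partial>distr M (M' j) (Z j)) \<partial>M)"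
proof -
  let ?Y = "\<lambda>\<omega>. restrict (\<lambda>i. Z i \<omega>) A" and ?W = "\<lambda>\<omega>. restrict (\<lambda>i. Z i \<omega>) {j}"
  have indep: "indep_var (PiM A M') ?Y (PiM {j} M') ?W"
    using A by (intro indep_var_restrict[OF ind]) auto
  then have [measurable]: "random_variable (PiM A M') ?Y" "random_variable (PiM {j} M') ?W"
    by (auto dest: indep_var_rv1 indep_var_rv2)
  have [measurable]: "random_variable (M' j) (Z j)"
    using ind A by (simp add: indep_vars_def)
  interpret W: prob_space "distr M (PiM {j} M') ?W"
    by (rule prob_space_distr) measurable
  have "(\<integral>\<^sup>+\<omega>. h (?Y \<omega>, Z j \<omega>) \<partial>M) =
      (\<integral>\<^sup>+p. h (fst p, snd p j) \<partial>distr M (PiM A M' \<Otimes>\<^sub>M PiM {j} M') (\<lambda>\<omega>. (?Y \<omega>, ?W \<omega>)))"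
    by (subst nn_integral_distr) auto
  also have "\<dots> = (\<integral>\<^sup>+p. h (fst p, snd p j) \<partial>(distr M (PiM A M') ?Y \<Otimes>\<^sub>M distr M (PiM {j} M') ?W))"
    using indep by (simp add: indep_var_distribution_eq)
  also have "\<dots> = (\<integral>\<^sup>+y. (\<integral>\<^sup>+z. h (y, z j) \<partial>distr M (PiM {j} M') ?W) \<partial>distr M (PiM A M') ?Y)"
    by (subst W.nn_integral_fst[symmetric]) (auto cong: measurable_cong_sets)
  also have "\<dots> = (\<integral>\<^sup>+y. (\<integral>\<^sup>+\<omega>. h (y, Z j \<omega>) \<partial>M) \<partial>distr M (PiM A M') ?Y)"
    by (intro nn_integral_cong, subst nn_integral_distr) auto
  also have "\<dots> = (\<integral>\<^sup>+\<omega>'. (\<integral>\<^sup>+\<omega>. h (?Y \<omega>', Z j \<omega>) \<partial>M) \<partial>M)"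
    by (rule nn_integral_distr) auto
  also have "\<dots> = (\<integral>\<^sup>+\<omega>. (\<integral>\<^sup>+y. h (?Y \<omega>, y) \<partial>distr M (M' j) (Z j)) \<partial>M)"
    by (intro nn_integral_cong, subst nn_integral_distr)
       (auto intro!: measurable_compose[OF _ h] measurable_Pair measurable_space[of ?Y M "PiM A M'"])
  finally show ?thesis .
qed

locale offer_stream = prob_space P for P :: "'a measure" +
  fixes D X :: "nat \<Rightarrow> 'a \<Rightarrow> real" and l :: real and \<nu> :: "real measure"
  assumes rate_pos: "0 < l"
    and indep: "indep_vars (\<lambda>_. borel) (\<lambda>k. case k of Inl i \<Rightarrow> D i | Inr i \<Rightarrow> X i) ({1..} <+> {1..})"
    and gap_law: "1 \<le> i \<Longrightarrow> distributed P lborel (D i) (exponential_density l)"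
    and offer_law: "1 \<le> i \<Longrightarrow> distr P borel (X i) = \<nu>"
begin

abbreviation exponential_law :: "real measure" where
  "exponential_law \<equiv> density lborel (exponential_density l)"

lemma measurable_gap [measurable]: "1 \<le> i \<Longrightarrow> D i \<in> borel_measurable P"
  using distributed_measurable[OF gap_law] by simp

lemma measurable_offer [measurable]: "1 \<le> i \<Longrightarrow> X i \<in> borel_measurable P"
  using indep by (auto simp: indep_vars_def dest!: bspec[of _ _ "Inr i"])

lemma distr_gap: "1 \<le> i \<Longrightarrow> distr P borel (D i) = exponential_law"
  using distributed_distr_eq_density[OF gap_law, of i] by (simp cong: distr_cong)

lemma AE_gaps_nonneg: "AE \<omega> in P. \<forall>i\<ge>1. 0 \<le> D i \<omega>"
proof -
  have "AE \<omega> in P. 1 \<le> i \<longrightarrow> 0 \<le> D i \<omega>" for i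
  proof (cases "1 \<le> i")
    case True
    have "AE x in exponential_law. 0 \<le> x"
      by (subst AE_density) (auto simp: exponential_density_def)
    then have "AE x in distr P borel (D i). 0 \<le> x"
      by (simp only: distr_gap True)
    then show ?thesis
      using AE_distrD[OF measurable_gap[OF True]] by simp
  qed simp
  then show ?thesis
    by (simp add: AE_all_countable)
qed

text \<open>
  As long as the remaining time stays positive, every gap is at most \<open>t\<close>. The gaps are independent
  with a common probability less than 1 of being at most \<open>t\<close>, so almost surely one of them exceeds \<open>t\<close>.
\<close>
lemma AE_time_left_eventually_less:
  assumes "0 \<le> t" "0 < s"
  shows "AE \<omega> in P. \<exists>n. time_left t (\<lambda>i. D i \<omega>) n < s"
proof -
  define c where "c = 1 - exp (- t * l)"
  have c: "0 \<le> c" "c < 1"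
    using assms rate_pos by (auto simp: c_def)
  have short: "prob {\<omega> \<in> space P. \<forall>i\<ge>1. D i \<omega> \<le> t} \<le> c ^ Suc n" for n
  proof -
    let ?J = "Inl ` {1..Suc n} :: (nat + nat) set"
    let ?Z = "\<lambda>k. case k of Inl i \<Rightarrow> D i | Inr i \<Rightarrow> X i"
    have "prob (\<Inter>k\<in>?J. ?Z k -` {..t} \<inter> space P) = (\<Prod>k\<in>?J. prob (?Z k -` {..t} \<inter> space P))"
      by (rule indep_varsD[OF indep]) auto
    also have "\<dots> = (\<Prod>i\<in>{1..Suc n}. prob (D i -` {..t} \<inter> space P))"
      by (subst prod.reindex) auto
    also have "\<dots> = (\<Prod>i\<in>{1..Suc n}. c)"
    proof (rule prod.cong[OF refl])
      fix i :: nat assume "i \<in> {1..Suc n}"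
      then show "prob (D i -` {..t} \<inter> space P) = c"
        using exponential_distributedD_le[OF gap_law, of i t] assms rate_pos
        by (auto simp: c_def vimage_def Int_def conj_commute)
    qed
    finally have "prob (\<Inter>k\<in>?J. ?Z k -` {..t} \<inter> space P) = c ^ Suc n"
      by simp
    moreover have "prob {\<omega> \<in> space P. \<forall>i\<ge>1. D i \<omega> \<le> t} \<le> prob (\<Inter>k\<in>?J. ?Z k -` {..t} \<inter> space P)"
      by (rule finite_measure_mono) auto
    ultimately show ?thesis by simp
  qed
  have "(\<lambda>n. c ^ Suc n) \<longlonglongrightarrow> 0"
    using c by (intro LIMSEQ_Suc LIMSEQ_realpow_zero)
  then have "prob {\<omega> \<in> space P. \<forall>i\<ge>1. D i \<omega> \<le> t} \<le> 0"
    by (rule LIMSEQ_le_const) (use short in auto)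
  then have "AE \<omega> in P. \<not> (\<forall>i\<ge>1. D i \<omega> \<le> t)"
    by (subst AE_iff_measurable[OF _ refl]) (auto simp: emeasure_eq_measure measure_le_0_iff)
  with AE_gaps_nonneg show ?thesis
  proof eventually_elim
    case (elim \<omega>)
    let ?\<tau> = "time_left t (\<lambda>i. D i \<omega>)"
    obtain i where "1 \<le> i" "t < D i \<omega>"
      using elim(2) by (auto simp: not_le)
    then obtain k where k: "t < D (Suc k) \<omega>"
      by (cases i) auto
    have "?\<tau> k \<le> ?\<tau> 0"
      using elim(1) assms by (intro time_left_antimono) auto
    then have "?\<tau> (Suc k) < s"
      using k assms by simp
    then show ?case by blast
  qed
qed

text \<open>
  The martingale property. A function \<open>E\<close> of the remaining time that is unchanged by conditioning on
  the next offer makes \<open>E\<close> of the remaining time, killed at the first accepted offer that counts, a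
  martingale. In the induction step the value of offer \<open>Suc n\<close> is integrated out first, because
  acceptance compares it with the threshold at a time that depends on gap \<open>Suc n\<close>; then that gap is
  integrated out, and the hypothesis on \<open>E\<close> restores the expression for \<open>n\<close>.
\<close>
lemma nn_integral_unsold:
  fixes E :: "real \<Rightarrow> ennreal"
  assumes [measurable]: "m \<in> borel_measurable borel" "E \<in> borel_measurable borel"
    and t: "0 \<le> t"
    and harmonic: "\<And>u. 0 \<le> u \<Longrightarrow> (\<integral>\<^sup>+d. (let v = max (u - d) 0 in
        (if s \<le> v then emeasure \<nu> {..<m v} else 1) * E v) \<partial>exponential_law) = E u"
  shows "(\<integral>\<^sup>+\<omega>. (if unsold m s t (\<lambda>i. D i \<omega>) (\<lambda>i. X i \<omega>) n
      then E (time_left t (\<lambda>i. D i \<omega>) n) else 0) \<partial>P) = E t"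
proof (induction n)
  case 0
  then show ?case
    by (simp add: emeasure_space_1)
next
  case (Suc n)
  \<comment> \<open>The expected value of the killed process when an offer arrives at remaining time \<open>v\<close>.\<close>
  define w where "w v = (if s \<le> v then emeasure \<nu> {..<m v} else 1) * E v" for v
  define Z where "Z k = (case k of Inl i \<Rightarrow> D i | Inr i \<Rightarrow> X i)" for k :: "nat + nat"
  define past where "past = Inl ` {1..n} \<union> (Inr ` {1..n} :: (nat + nat) set)"
  let ?past' = "insert (Inl (Suc n)) past"
  let ?\<tau> = "\<lambda>f. time_left t (\<lambda>i. f (Inl i))"
  let ?unsold = "\<lambda>f. unsold m s t (\<lambda>i. f (Inl i)) (\<lambda>i. f (Inr i))"
  interpret \<nu>: real_distribution \<nu>
    using real_distribution_distr[OF measurable_offer[of 1]] by (simp add: offer_law[of 1, simplified])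
  note \<nu>.measurable_emeasure_lessThan [measurable]
  have Z_simps: "Z (Inl i) = D i" "Z (Inr i) = X i" for i
    by (simp_all add: Z_def)
  have indZ: "indep_vars (\<lambda>_. borel) Z ({1..} <+> {1..})"
    using indep unfolding Z_def .
  have [measurable]: "w \<in> borel_measurable borel"
    unfolding w_def by measurable
  have gap_int: "(\<integral>\<^sup>+d. w (max (u - d) 0) \<partial>exponential_law) = E u" if "0 \<le> u" for u
    using harmonic[OF that] by (simp add: w_def Let_def)
  have offer_int: "(\<integral>\<^sup>+x. (if s \<le> v \<longrightarrow> x < m v then E v else 0) \<partial>\<nu>) = w v" for v
  proof (cases "s \<le> v")
    case True
    have "(\<integral>\<^sup>+x. (if s \<le> v \<longrightarrow> x < m v then E v else 0) \<partial>\<nu>) = (\<integral>\<^sup>+x. E v * indicator {..<m v} x \<partial>\<nu>)"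
      using True by (intro nn_integral_cong) auto
    then show ?thesis
      using True by (simp add: nn_integral_cmult_indicator w_def mult.commute)
  qed (use \<nu>.emeasure_space_1 in \<open>simp add: w_def\<close>)
  have [measurable]: "(\<lambda>f. ?\<tau> f n) \<in> borel_measurable (PiM J (\<lambda>_. borel))"
    "Measurable.pred (PiM J (\<lambda>_. borel)) (\<lambda>f. ?unsold f n)" if "past \<subseteq> J" for J
    using that by (auto intro!: measurable_time_left measurable_unsold measurable_component_singleton simp: past_def)
  have [measurable]: "(\<lambda>f. ?\<tau> f (Suc n)) \<in> borel_measurable (PiM ?past' (\<lambda>_. borel))"
    by (auto intro!: measurable_time_left measurable_component_singleton simp: past_def simp del: time_left.simps)
  have past_sub [measurable, simp]: "past \<subseteq> past" "past \<subseteq> ?past'"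
    by auto
  define h where "h p = (if ?unsold (fst p) n then
      (if s \<le> ?\<tau> (fst p) (Suc n) \<longrightarrow> snd p < m (?\<tau> (fst p) (Suc n)) then E (?\<tau> (fst p) (Suc n)) else 0) else 0)"
    for p :: "(nat + nat \<Rightarrow> real) \<times> real"
  define g where "g p = (if ?unsold (fst p) n then w (max (?\<tau> (fst p) n - snd p) 0) else 0)"
    for p :: "(nat + nat \<Rightarrow> real) \<times> real"
  have [measurable]: "h \<in> borel_measurable (PiM ?past' (\<lambda>_. borel) \<Otimes>\<^sub>M borel)"
    unfolding h_def by measurable
  have [measurable]: "g \<in> borel_measurable (PiM past (\<lambda>_. borel) \<Otimes>\<^sub>M borel)"
    unfolding g_def by measurable
  define R where "R J \<omega> = restrict (\<lambda>k. Z k \<omega>) J" for J \<omega>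
  let ?unsold_n = "\<lambda>\<omega>. unsold m s t (\<lambda>i. D i \<omega>) (\<lambda>i. X i \<omega>) n" and ?\<sigma> = "\<lambda>\<omega>. time_left t (\<lambda>i. D i \<omega>)"
  have unsold_R: "?unsold (R J \<omega>) n \<longleftrightarrow> ?unsold_n \<omega>" if "past \<subseteq> J" for J \<omega>
    using that by (intro unsold_cong) (auto simp: R_def Z_simps past_def subset_eq)
  have time_left_R: "?\<tau> (R past \<omega>) n = ?\<sigma> \<omega> n" "?\<tau> (R ?past' \<omega>) (Suc n) = ?\<sigma> \<omega> (Suc n)" for \<omega>
    by (intro time_left_cong; force simp: R_def Z_simps past_def le_Suc_eq)+
  have h_R: "h (R ?past' \<omega>, x) = (if ?unsold_n \<omega> then
      (if s \<le> ?\<sigma> \<omega> (Suc n) \<longrightarrow> x < m (?\<sigma> \<omega> (Suc n)) then E (?\<sigma> \<omega> (Suc n)) else 0) else 0)" for \<omega> x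
    unfolding h_def fst_conv snd_conv unsold_R[OF past_sub(2)] time_left_R ..
  have g_R: "g (R past \<omega>, d) = (if ?unsold_n \<omega> then w (max (?\<sigma> \<omega> n - d) 0) else 0)" for \<omega> d
    unfolding g_def fst_conv snd_conv unsold_R[OF past_sub(1)] time_left_R ..
  have fresh_offer: "?past' \<subseteq> {1..} <+> {1..}" "Inr (Suc n) \<in> {1..} <+> {1..}" "Inr (Suc n) \<notin> ?past'"
    and fresh_gap: "past \<subseteq> {1..} <+> {1..}" "Inl (Suc n) \<in> {1..} <+> {1..}" "Inl (Suc n) \<notin> past"
    by (auto simp: past_def)
  have "(\<integral>\<^sup>+\<omega>. (if unsold m s t (\<lambda>i. D i \<omega>) (\<lambda>i. X i \<omega>) (Suc n) then E (?\<sigma> \<omega> (Suc n)) else 0) \<partial>P) =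
      (\<integral>\<^sup>+\<omega>. h (R ?past' \<omega>, Z (Inr (Suc n)) \<omega>) \<partial>P)"
    by (intro nn_integral_cong)
       (simp add: h_R unsold_Suc Z_simps del: time_left.simps)
  also have "\<dots> = (\<integral>\<^sup>+\<omega>. (\<integral>\<^sup>+x. h (R ?past' \<omega>, x) \<partial>distr P borel (Z (Inr (Suc n)))) \<partial>P)"
    unfolding R_def by (rule nn_integral_fresh_variable[OF indZ fresh_offer]) measurable
  also have "\<dots> = (\<integral>\<^sup>+\<omega>. (if ?unsold_n \<omega> then w (?\<sigma> \<omega> (Suc n)) else 0) \<partial>P)"
    by (intro nn_integral_cong)
       (simp add: h_R offer_int offer_law Z_simps del: time_left.simps)
  also have "\<dots> = (\<integral>\<^sup>+\<omega>. g (R past \<omega>, Z (Inl (Suc n)) \<omega>) \<partial>P)"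
    by (simp only: g_R Z_simps time_left.simps)
  also have "\<dots> = (\<integral>\<^sup>+\<omega>. (\<integral>\<^sup>+d. g (R past \<omega>, d) \<partial>distr P borel (Z (Inl (Suc n)))) \<partial>P)"
    unfolding R_def by (rule nn_integral_fresh_variable[OF indZ fresh_gap]) measurable
  also have "\<dots> = (\<integral>\<^sup>+\<omega>. (if ?unsold_n \<omega> then E (?\<sigma> \<omega> n) else 0) \<partial>P)"
    by (intro nn_integral_cong)
       (simp add: g_R Z_simps distr_gap gap_int time_left_nonneg t)
  finally show ?case
    using Suc by simp
qed

text \<open>
  Optional stopping: almost surely the remaining time drops below \<open>s\<close>, where \<open>E\<close> is 1 and the
  indicator in the martingale no longer changes. The bounded martingale therefore converges to the
  indicator of the event, and the expectation stays equal to its initial value \<open>E t\<close>.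
\<close>
lemma prob_always_unsold:
  fixes E :: "real \<Rightarrow> ennreal"
  assumes [measurable]: "m \<in> borel_measurable borel" "E \<in> borel_measurable borel"
    and t: "0 \<le> t" and s: "0 < s"
    and le_1: "\<And>u. E u \<le> 1" and eq_1: "\<And>u. u < s \<Longrightarrow> E u = 1"
    and harmonic: "\<And>u. 0 \<le> u \<Longrightarrow> (\<integral>\<^sup>+d. (let v = max (u - d) 0 in
        (if s \<le> v then emeasure \<nu> {..<m v} else 1) * E v) \<partial>exponential_law) = E u"
  shows "emeasure P {\<omega> \<in> space P. \<forall>n. unsold m s t (\<lambda>i. D i \<omega>) (\<lambda>i. X i \<omega>) n} = E t"
proof -
  let ?U = "\<lambda>\<omega>. unsold m s t (\<lambda>i. D i \<omega>) (\<lambda>i. X i \<omega>)"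
  let ?\<tau> = "\<lambda>\<omega>. time_left t (\<lambda>i. D i \<omega>)"
  have [measurable]: "Measurable.pred P (\<lambda>\<omega>. ?U \<omega> n)" "(\<lambda>\<omega>. ?\<tau> \<omega> n) \<in> borel_measurable P" for n
    by (auto intro!: measurable_unsold measurable_time_left)
  have "(\<lambda>n. \<integral>\<^sup>+\<omega>. (if ?U \<omega> n then E (?\<tau> \<omega> n) else 0) \<partial>P) \<longlonglongrightarrow>
      (\<integral>\<^sup>+\<omega>. indicator {\<omega> \<in> space P. \<forall>n. ?U \<omega> n} \<omega> \<partial>P)"
  proof (rule nn_integral_dominated_convergence[where w="\<lambda>_. 1"])
    show "AE \<omega> in P. (if ?U \<omega> n then E (?\<tau> \<omega> n) else 0) \<le> 1" for n
      by (simp add: le_1)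
    show "AE \<omega> in P. (\<lambda>n. (if ?U \<omega> n then E (?\<tau> \<omega> n) else 0)) \<longlonglongrightarrow>
        indicator {\<omega> \<in> space P. \<forall>n. ?U \<omega> n} \<omega>"
      using AE_gaps_nonneg AE_time_left_eventually_less[OF t s] AE_space
    proof eventually_elim
      case (elim \<omega>)
      obtain N where N: "?\<tau> \<omega> N < s"
        using elim(2) by blast
      have "(if ?U \<omega> n then E (?\<tau> \<omega> n) else 0) = indicator {\<omega> \<in> space P. \<forall>n. ?U \<omega> n} \<omega>"
        if "N \<le> n" for n
      proof -
        have "?\<tau> \<omega> n \<le> ?\<tau> \<omega> N"
          using elim(1) t that by (intro time_left_antimono) auto
        then have "?\<tau> \<omega> n < s"
          using N by simp
        then show ?thesis
          using unsold_stabilizes[where d="\<lambda>i. D i \<omega>" and t=t and n=n and s=s and m=m] elim(1,3) t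
          by (simp add: eq_1 indicator_def)
      qed
      then show ?case
        by (intro tendsto_eventually eventually_sequentiallyI)
    qed
  qed (auto simp: emeasure_space_1)
  then have "(\<lambda>n. E t) \<longlonglongrightarrow> emeasure P {\<omega> \<in> space P. \<forall>n. ?U \<omega> n}"
    by (simp add: nn_integral_unsold[OF assms(1,2) t harmonic])
  then show ?thesis
    by (simp add: LIMSEQ_const_iff)
qed

end

section \<open>The distribution of the time to sale\<close>

theorem theorem4p1:
  fixes l \<mu>0 t :: real
    and F F0 :: "real \<Rightarrow> real"
    and P :: "'a measure"
    and D X :: "nat \<Rightarrow> 'a \<Rightarrow> real"
    and \<phi> \<mu> H :: "real \<Rightarrow> real"
    and T :: "'a \<Rightarrow> real"
  assumes "0 < l"
    and "is_cdf F" and "is_cdf F0"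
    and "integrable (interval_measure F) (\<lambda>x. max x 0)"
    and "integrable (interval_measure F0) (\<lambda>x. \<bar>x\<bar>)"
    and "\<mu>0 = (\<integral>x. x \<partial>interval_measure F0)"
    and "0 \<le> \<mu>0" and "ereal \<mu>0 < upper_end F"
    and "prob_space P"
    and "prob_space.indep_vars P (\<lambda>_. borel)
           (\<lambda>k. case k of Inl i \<Rightarrow> D i | Inr i \<Rightarrow> X i) ({1..} <+> {1..})"
    and "\<And>i. 1 \<le> i \<Longrightarrow> distributed P lborel (D i) (exponential_density l)"
    and "\<And>i. 1 \<le> i \<Longrightarrow> cdf (distr P borel (X i)) = F"
    and "0 \<le> t"
  defines "\<phi> \<equiv> phi F"
    and "\<mu> \<equiv> opt_policy l F \<mu>0"
    and "T \<equiv> (\<lambda>\<omega>. time_to_sale \<mu> t (\<lambda>i. D i \<omega>) (\<lambda>i. X i \<omega>))"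
    and "H \<equiv> (\<lambda>r. \<P>(\<omega> in P. T \<omega> \<le> r))"
  shows "T \<in> borel_measurable P \<and>
    (\<forall>r\<ge>0. H r = (if r < t then 1 - \<phi> (\<mu> t) / \<phi> (\<mu> (t - r)) else 1)) \<and>
    (\<exists>H_plus H_minus.
       (H \<longlongrightarrow> H_plus) (at_right t) \<and>
       (if t = 0 then H_minus = 0 else (H \<longlongrightarrow> H_minus) (at_left t)) \<and>
       \<P>(\<omega> in P. T \<omega> = t) = H_plus - H_minus \<and>
       H_plus - H_minus = \<phi> (\<mu> t) / \<phi> \<mu>0)"
proof -
  interpret P: prob_space P by fact
  interpret policy: optimal_policy F l \<mu>0
    by unfold_locales fact+
  have X_measurable: "X i \<in> borel_measurable P" if "1 \<le> i" for i
    using assms(10) that by (auto simp: P.indep_vars_def dest!: bspec[of _ _ "Inr i"])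
  \<comment> \<open>A distribution on the line is determined by its distribution function.\<close>
  have "distr P borel (X i) = interval_measure F" if "1 \<le> i" for i
    using assms(12)[OF that] policy.cdf_law policy.law.real_distribution_axioms
    by (intro cdf_unique P.real_distribution_distr X_measurable that) auto
  then interpret offers: offer_stream P D X l "interval_measure F"
    using assms by unfold_locales auto
  note \<open>0 \<le> t\<close>[simp]
  let ?d = "\<lambda>\<omega> i. D i \<omega>" and ?x = "\<lambda>\<omega> i. X i \<omega>"
  have T_eq: "T = (\<lambda>\<omega>. time_to_sale policy.extended_policy t (?d \<omega>) (?x \<omega>))"
    unfolding T_def \<mu>_def by (intro ext time_to_sale_cong) (simp add: policy.extended_policy_eq)
  have T_measurable [measurable]: "T \<in> borel_measurable P"
    unfolding T_eq by (intro measurable_time_to_sale) auto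
  have T_le: "T \<omega> \<le> t" for \<omega>
    unfolding T_def by (rule time_to_sale_le)
  have H_1: "H r = 1" if "t \<le> r" for r
  proof -
    have "T \<omega> \<le> r" for \<omega>
      using T_le[of \<omega>] that by simp
    then show ?thesis
      by (simp add: H_def P.prob_space)
  qed
  have H_less: "H r = 1 - \<phi> (\<mu> t) / \<phi> (\<mu> (t - r))" if r: "0 \<le> r" "r < t" for r
  proof -
    let ?s = "t - r"
    let ?U = "{\<omega> \<in> space P. \<forall>n. unsold policy.extended_policy ?s t (?d \<omega>) (?x \<omega>) n}"
    have [measurable]: "?U \<in> sets P"
    proof -
      have [measurable]: "Measurable.pred P (\<lambda>\<omega>. unsold policy.extended_policy ?s t (?d \<omega>) (?x \<omega>) n)" for n
        by (auto intro!: measurable_unsold)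
      show ?thesis by measurable
    qed
    have "emeasure P ?U = ennreal (policy.no_sale_prob ?s t)"
    proof (rule offers.prob_always_unsold[where E="\<lambda>v. ennreal (policy.no_sale_prob ?s v)"])
      have [measurable]: "policy.no_sale_prob ?s \<in> borel_measurable borel"
        using r by simp
      show "(\<lambda>v. ennreal (policy.no_sale_prob ?s v)) \<in> borel_measurable borel"
        by measurable
      show "ennreal (policy.no_sale_prob ?s v) \<le> 1" for v
        using r policy.no_sale_prob_bounds(2)[of ?s v] by simp
      show "ennreal (policy.no_sale_prob ?s v) = 1" if "v < ?s" for v
        using that by (simp only: policy.no_sale_prob_def if_True ennreal_1)
    qed (use r policy.no_sale_prob_harmonic in auto)
    then have U: "P.prob ?U = policy.no_sale_prob ?s t"
      using r policy.no_sale_prob_bounds(1)[of ?s t] by (simp add: P.emeasure_eq_measure)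
    \<comment> \<open>The path description of the event requires nonnegative gaps, which hold only almost surely.\<close>
    have "AE \<omega> in P. T \<omega> \<le> r \<longleftrightarrow> \<not> (\<forall>n. unsold policy.extended_policy ?s t (?d \<omega>) (?x \<omega>) n)"
      using offers.AE_gaps_nonneg
    proof eventually_elim
      case (elim \<omega>)
      then show ?case
        using r time_to_sale_le_iff[of "?d \<omega>" t ?s policy.extended_policy "?x \<omega>"] by (simp add: T_eq)
    qed
    then have "H r = P.prob (space P - ?U)"
      unfolding H_def by (intro P.finite_measure_eq_AE) auto
    also have "\<dots> = 1 - policy.no_sale_prob ?s t"
      by (simp add: P.prob_compl U)
    finally show ?thesis
      using r by (simp add: policy.no_sale_prob_def \<phi>_def \<mu>_def)
  qed
  have H_formula: "\<forall>r\<ge>0. H r = (if r < t then 1 - \<phi> (\<mu> t) / \<phi> (\<mu> (t - r)) else 1)"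
    using H_less H_1 by simp
  have right: "(H \<longlongrightarrow> 1) (at_right t)"
    by (rule tendsto_eventually)
       (auto simp: eventually_at_filter H_1 intro!: always_eventually)
  have \<phi>0: "0 < \<phi> \<mu>0"
    unfolding \<phi>_def by (rule policy.phi_pos[OF assms(8)])
  show ?thesis
  proof (cases "t = 0")
    case True
    \<comment> \<open>With no time left at the start, nonnegative gaps keep the remaining time at 0, and offers
      arriving then are never accepted.\<close>
    have "AE \<omega> in P. T \<omega> = t"
      using offers.AE_gaps_nonneg
    proof eventually_elim
      case (elim \<omega>)
      have "time_left t (?d \<omega>) i \<le> time_left t (?d \<omega>) 0" for i
        using elim by (intro time_left_antimono) auto
      then show ?case
        using True by (auto simp: T_def time_to_sale_def accepted_def not_less[symmetric])
    qed
    then have "\<P>(\<omega> in P. T \<omega> = t) = 1"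
      by (simp add: P.prob_Collect_eq_1)
    moreover have "\<phi> (\<mu> t) / \<phi> \<mu>0 = 1"
      using True \<phi>0 by (simp add: \<mu>_def policy.policy_0)
    ultimately show ?thesis
      using T_measurable H_formula right True by (intro conjI exI[of _ 1] exI[of _ 0]) auto
  next
    case False
    then have "0 < t" by (simp add: less_le)
    interpret T: real_distribution "distr P borel T"
      by (rule P.real_distribution_distr) measurable
    have H_cdf: "H = cdf (distr P borel T)"
      by (auto simp: fun_eq_iff H_def cdf_def measure_distr vimage_def Int_def conj_commute)
    have "((\<lambda>r. 1 - \<phi> (\<mu> t) / \<phi> (\<mu> (t - r))) \<longlongrightarrow> 1 - \<phi> (\<mu> t) / \<phi> (\<mu> (t - t))) (at_left t)"
    proof -
      have "continuous_on {..t} (\<lambda>r. \<phi> (\<mu> (t - r)))"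
        unfolding \<phi>_def \<mu>_def
        by (intro continuous_on_compose2[OF policy.continuous_on_phi[of UNIV]]
            continuous_on_compose2[OF policy.policy_continuous_on] continuous_intros) auto
      then have "((\<lambda>r. \<phi> (\<mu> (t - r))) \<longlongrightarrow> \<phi> (\<mu> (t - t))) (at t within {..t})"
        unfolding continuous_on_def by (rule bspec[where x=t]) simp
      then have "((\<lambda>r. \<phi> (\<mu> (t - r))) \<longlongrightarrow> \<phi> (\<mu> (t - t))) (at_left t)"
        by (rule tendsto_within_subset) auto
      then show ?thesis
        using \<phi>0 by (intro tendsto_intros) (auto simp: \<mu>_def policy.policy_0)
    qed
    moreover have "eventually (\<lambda>r. 1 - \<phi> (\<mu> t) / \<phi> (\<mu> (t - r)) = H r) (at_left t)"
      using eventually_at_left_real[OF \<open>0 < t\<close>] by eventually_elim (simp add: H_less)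
    ultimately have left: "(H \<longlongrightarrow> 1 - \<phi> (\<mu> t) / \<phi> \<mu>0) (at_left t)"
      by (rule Lim_transform_eventually[THEN back_subst[of "\<lambda>x. (H \<longlongrightarrow> x) (at_left t)"]])
         (simp add: \<mu>_def policy.policy_0)
    \<comment> \<open>The left limit of a distribution function at \<open>t\<close> is the mass below \<open>t\<close>, so the atom at \<open>t\<close>
      is what the left limit leaves of the total mass.\<close>
    have "measure (distr P borel T) {..<t} = 1 - \<phi> (\<mu> t) / \<phi> \<mu>0"
      using T.cdf_at_left[of t] left unfolding H_cdf
      by (intro tendsto_unique[OF trivial_limit_at_left_real])
    moreover have "\<P>(\<omega> in P. T \<omega> = t) = 1 - measure (distr P borel T) {..<t}"
    proof -
      have "{\<omega> \<in> space P. T \<omega> = t} = space P - T -` {..<t} \<inter> space P"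
        using T_le by (auto simp: not_less intro: antisym)
      then show ?thesis
        by (simp add: measure_distr P.prob_compl)
    qed
    ultimately show ?thesis
      using T_measurable H_formula right left False
      by (intro conjI exI[of _ 1] exI[of _ "1 - \<phi> (\<mu> t) / \<phi> \<mu>0"]) auto
  qed
qed

end
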